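(* Let $K$ be a field of characteristic zero, let $n\ge 2$, let $P_n=K[x_1,\dots,x_n]$ be the polynomial algebra, and let $\sigma$ be the $K$-algebra automorphism of $P_n$ given by $\sigma(x_1)=x_1-1$ and $\sigma(x_i)=x_i+x_{i-1}$ for $2\le i\le n$. Set $m:=[\frac n2]$ and $\mu:=[\frac{n-1}2]$. Let $u_1,\dots,u_m$ and $v_1,\dots,v_\mu$ be the explicit quadratic and cubic polynomials defined in the context. Then: 1. $P_n^\sigma=K[u_1,\dots,u_m,v_1,\dots,v_\mu]$ is a polynomial ring in the $n-1$ $(=m+\mu)$ variables $u_1,\dots,u_m,v_1,\dots,v_\mu$. 2. $P_n=P_n^\sigma[x_1]$.
   Context: $P_n^\sigma=\{f:\sigma(f)=f\}$; $[r]$ is the floor of $r$. Convention: $\binom{a}{b}=0$ for integers $a,b$ not satisfying $0\le b\le a$. For $k\ge 1$, $$u_k=x_k^2+\sum_{i=1}^{k-1}\sum_{j=k}^{2k-i}\lambda_{i,j}^k x_ix_j+\sum_{i=k}^{2k}\mu_i^kx_i,$$ with $\lambda_{i,j}^k=(-1)^{k-i}\{\binom{k-i}{j-k}+\binom{k-i-1}{j-k-1}\}$ and $\mu_i^k=(-1)^{k-1}\{\binom{k}{i-k}+\binom{k-1}{i-k-1}\}$. Next, $v_1=x_1^3+3x_1x_2-x_1+3x_3$, and for $k\ge 2$, $$v_k=x_1u_k+x_kx_{k+1}+\sum_{i=1}^{k-1}\sum_{j=k+1}^{2k-i+1}\alpha_{i,j}^k x_ix_j+\sum_{i=k+1}^{2k+1}\beta_i^kx_i,$$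 with $\alpha_{i,j}^k=(-1)^{k-i}\{2\binom{k-i-1}{j-k-1}+3\binom{k-i-1}{j-k-2}+(k-i-1)[\binom{k-i}{j-k-1}+\binom{k-i-1}{j-k-2}]\}$ and $\beta_j^k=\alpha_{1,j-1}^k+\alpha_{1,j}^k+\mu_{j-1}^k$ for $j=k+1,\dots,2k+1$. *)

theory Defs
  imports Complex_Main "HOL-Library.Poly_Mapping" "HOL-Computational_Algebra.Polynomial"
begin

text \<open>
  Polynomials over \<open>'k\<close> in the variables \<open>x\<^sub>0, x\<^sub>1, x\<^sub>2, \<dots>\<close> are finitely supported functions from
  exponent vectors to coefficients, with the convolution product of \<^theory>\<open>HOL-Library.Poly_Mapping\<close>.
  The ring \<open>P\<^sub>n = K[x\<^sub>1, \<dots>, x\<^sub>n]\<close> is the subset of those in which only \<open>x\<^sub>1, \<dots>, x\<^sub>n\<close> occur.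
\<close>

type_synonym 'k mpoly = "(nat \<Rightarrow>\<^sub>0 nat) \<Rightarrow>\<^sub>0 'k"

definition Const :: "'k::comm_ring_1 \<Rightarrow> 'k mpoly" where
  "Const c = Poly_Mapping.single 0 c"

definition X :: "nat \<Rightarrow> 'k::comm_ring_1 mpoly" where
  "X i = Poly_Mapping.single (Poly_Mapping.single i 1) 1"

definition P :: "nat \<Rightarrow> 'k::comm_ring_1 mpoly set" where
  "P n = {f. \<forall>e \<in> Poly_Mapping.keys f. Poly_Mapping.keys e \<subseteq> {1..n}}"

definition subst :: "(nat \<Rightarrow> 'k::comm_ring_1 mpoly) \<Rightarrow> 'k mpoly \<Rightarrow> 'k mpoly" where
  "subst w f = (\<Sum>e \<in> Poly_Mapping.keys f. Const (Poly_Mapping.lookup f e) *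
      (\<Prod>i \<in> Poly_Mapping.keys e. w i ^ Poly_Mapping.lookup e i))"

definition algebra_automorphism :: "nat \<Rightarrow> ('k::comm_ring_1 mpoly \<Rightarrow> 'k mpoly) \<Rightarrow> bool" where
  "algebra_automorphism n \<sigma> \<longleftrightarrow>
     bij_betw \<sigma> (P n) (P n) \<and>
     (\<forall>c. \<sigma> (Const c) = Const c) \<and>
     (\<forall>f \<in> P n. \<forall>g \<in> P n. \<sigma> (f + g) = \<sigma> f + \<sigma> g) \<and>
     (\<forall>f \<in> P n. \<forall>g \<in> P n. \<sigma> (f * g) = \<sigma> f * \<sigma> g)"

definition invariants :: "nat \<Rightarrow> ('k::comm_ring_1 mpoly \<Rightarrow> 'k mpoly) \<Rightarrow> 'k mpoly set" where
  "invariants n \<sigma> = {f \<in> P n. \<sigma> f = f}"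

inductive_set generated_subalgebra :: "'k::comm_ring_1 mpoly set \<Rightarrow> 'k mpoly set"
  for S :: "'k mpoly set" where
  const: "Const c \<in> generated_subalgebra S"
| gen: "s \<in> S \<Longrightarrow> s \<in> generated_subalgebra S"
| add: "f \<in> generated_subalgebra S \<Longrightarrow> g \<in> generated_subalgebra S \<Longrightarrow> f + g \<in> generated_subalgebra S"
| mult: "f \<in> generated_subalgebra S \<Longrightarrow> g \<in> generated_subalgebra S \<Longrightarrow> f * g \<in> generated_subalgebra S"

text \<open>Algebraic independence over \<open>K\<close> of the family \<open>w 1, \<dots>, w r\<close> (as a family, so that
  in particular the members are pairwise distinct).\<close>

definition algebraically_independent :: "nat \<Rightarrow> (nat \<Rightarrow> 'k::comm_ring_1 mpoly) \<Rightarrow> bool" where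
  "algebraically_independent r w \<longleftrightarrow> (\<forall>f \<in> P r. subst w f = 0 \<longrightarrow> f = 0)"

text \<open>\<open>A = K[w 1, \<dots>, w r]\<close> is a polynomial ring in the \<open>r\<close> variables \<open>w 1, \<dots>, w r\<close>.\<close>

definition polynomial_ring_in :: "'k::comm_ring_1 mpoly set \<Rightarrow> nat \<Rightarrow> (nat \<Rightarrow> 'k mpoly) \<Rightarrow> bool" where
  "polynomial_ring_in A r w \<longleftrightarrow>
     A = generated_subalgebra (w ` {1..r}) \<and> algebraically_independent r w"

text \<open>\<open>B = A[y]\<close> is a polynomial ring in the variable \<open>y\<close> over the subring \<open>A\<close>: every element
  of \<open>B\<close> is a polynomial in \<open>y\<close> with coefficients in \<open>A\<close>, and \<open>y\<close> is transcendental over \<open>A\<close>.\<close>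

definition polynomial_extension :: "'k::comm_ring_1 mpoly set \<Rightarrow> 'k mpoly set \<Rightarrow> 'k mpoly \<Rightarrow> bool" where
  "polynomial_extension B A y \<longleftrightarrow>
     B = {poly p y | p. \<forall>i. coeff p i \<in> A} \<and>
     (\<forall>p. (\<forall>i. coeff p i \<in> A) \<and> poly p y = 0 \<longrightarrow> p = 0)"

text \<open>Binomial coefficients of integers, zero unless \<open>0 \<le> b \<le> a\<close>. The lower arguments below can be
  negative, so the differences are taken in \<^typ>\<open>int\<close>.\<close>

definition binom :: "int \<Rightarrow> int \<Rightarrow> int" where
  "binom a b = (if 0 \<le> b \<and> b \<le> a then int (nat a choose nat b) else 0)"

text \<open>The coefficients below are used only for \<open>1 \<le> i\<close> and \<open>i < k\<close> (\<open>\<lambda>\<close>, \<open>\<alpha>\<close>),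
  \<open>1 \<le> k\<close> (\<open>\<mu>\<close>) and \<open>k < j\<close> (\<open>\<beta>\<close>); there no subtraction on \<^typ>\<open>nat\<close> truncates.\<close>

definition lambda_coeff :: "nat \<Rightarrow> nat \<Rightarrow> nat \<Rightarrow> int" where
  "lambda_coeff k i j = (-1) ^ (k - i) *
     (binom (int k - int i) (int j - int k) + binom (int k - int i - 1) (int j - int k - 1))"

definition mu_coeff :: "nat \<Rightarrow> nat \<Rightarrow> int" where
  "mu_coeff k i = (-1) ^ (k - 1) *
     (binom (int k) (int i - int k) + binom (int k - 1) (int i - int k - 1))"

definition alpha_coeff :: "nat \<Rightarrow> nat \<Rightarrow> nat \<Rightarrow> int" where
  "alpha_coeff k i j = (-1) ^ (k - i) *
     (2 * binom (int k - int i - 1) (int j - int k - 1)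
      + 3 * binom (int k - int i - 1) (int j - int k - 2)
      + (int k - int i - 1) *
        (binom (int k - int i) (int j - int k - 1) + binom (int k - int i - 1) (int j - int k - 2)))"

definition beta_coeff :: "nat \<Rightarrow> nat \<Rightarrow> int" where
  "beta_coeff k j = alpha_coeff k 1 (j - 1) + alpha_coeff k 1 j + mu_coeff k (j - 1)"

definition u :: "nat \<Rightarrow> 'k::comm_ring_1 mpoly" where
  "u k = X k ^ 2
     + (\<Sum>i = 1..k - 1. \<Sum>j = k..2 * k - i. of_int (lambda_coeff k i j) * X i * X j)
     + (\<Sum>i = k..2 * k. of_int (mu_coeff k i) * X i)"

definition v :: "nat \<Rightarrow> 'k::comm_ring_1 mpoly" where
  "v k = (if k = 1 then X 1 ^ 3 + 3 * X 1 * X 2 - X 1 + 3 * X 3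
     else X 1 * u k + X k * X (k + 1)
       + (\<Sum>i = 1..k - 1. \<Sum>j = k + 1..2 * k - i + 1. of_int (alpha_coeff k i j) * X i * X j)
       + (\<Sum>i = k + 1..2 * k + 1. of_int (beta_coeff k i) * X i))"

text \<open>The family \<open>u\<^sub>1, \<dots>, u\<^sub>m, v\<^sub>1, v\<^sub>2, \<dots>\<close>, indexed from \<open>1\<close>.\<close>

definition uv :: "nat \<Rightarrow> nat \<Rightarrow> 'k::comm_ring_1 mpoly" where
  "uv m i = (if i \<le> m then u i else v (i - m))"

end

theory Submission
  imports Defs
begin

text \<open>
  Put \<open>x\<^sub>0 = -1\<close> and \<open>x\<^sub>i = 0\<close> for \<open>i < 0\<close>, so that \<open>\<sigma>(x\<^sub>i) = x\<^sub>i + x\<^sub>i\<^sub>-\<^sub>1\<close> for every integer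
  \<open>i\<close>. Then \<open>u\<^sub>k\<close> and \<open>v\<^sub>k - x\<^sub>1 u\<^sub>k\<close> become homogeneous quadratic forms whose coefficients obey
  Pascal-type recursions, and telescoping gives \<open>\<sigma>(u\<^sub>k) = u\<^sub>k\<close> and \<open>\<sigma>(v\<^sub>k) = v\<^sub>k\<close>. Moreover
  \<open>u\<^sub>k\<close> and \<open>v\<^sub>k\<close> are nonzero multiples of \<open>x\<^sub>2\<^sub>k\<close> and \<open>x\<^sub>2\<^sub>k\<^sub>+\<^sub>1\<close> modulo polynomials in the
  preceding variables, so by triangularity \<open>x\<^sub>1\<close>, the \<open>u\<^sub>k\<close> and the \<open>v\<^sub>k\<close> are free generators of
  \<open>P\<^sub>n\<close>. Finally, if a polynomial \<open>p\<close> with \<open>\<sigma>\<close>-invariant coefficients has an invariant value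
  \<open>p(x\<^sub>1) = f\<close>, then \<open>p(x\<^sub>1 - j) = f\<close> for all \<open>j\<close>, so \<open>p\<close> is the constant \<open>f\<close>; this yields both the
  remaining inclusion for the invariant ring and the transcendence of \<open>x\<^sub>1\<close> over it.
\<close>

section \<open>Substitution homomorphisms\<close>

lemma Const_0 [simp]: "Const 0 = 0"
  by (simp add: Const_def)

lemma Const_1 [simp]: "Const 1 = 1"
  by (simp add: Const_def)

lemma Const_add: "Const (a + b) = Const a + Const b"
  by (simp add: Const_def single_add)

lemma Const_mult: "Const (a * b) = Const a * Const b"
  by (simp add: Const_def mult_single)

lemma Const_of_int: "Const (of_int k) = of_int k"
  by (simp add: Const_def)

definition mon :: "(nat \<Rightarrow> 'k::comm_ring_1 mpoly) \<Rightarrow> (nat \<Rightarrow>\<^sub>0 nat) \<Rightarrow> 'k mpoly" where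
  "mon w e = (\<Prod>i \<in> Poly_Mapping.keys e. w i ^ Poly_Mapping.lookup e i)"

lemma mon_eq_prod:
  assumes "finite F" "Poly_Mapping.keys e \<subseteq> F"
  shows "mon w e = (\<Prod>i\<in>F. w i ^ Poly_Mapping.lookup e i)"
  unfolding mon_def by (rule prod.mono_neutral_left) (use assms in \<open>auto simp: in_keys_iff\<close>)

lemma mon_add: "mon w (e + e') = mon w e * mon w e'"
proof -
  let ?F = "Poly_Mapping.keys e \<union> Poly_Mapping.keys e'"
  have "mon w (e + e') = (\<Prod>i\<in>?F. w i ^ Poly_Mapping.lookup (e + e') i)"
    by (rule mon_eq_prod) (use Poly_Mapping.keys_add[of e e'] in auto)
  also have "\<dots> = (\<Prod>i\<in>?F. w i ^ Poly_Mapping.lookup e i) * (\<Prod>i\<in>?F. w i ^ Poly_Mapping.lookup e' i)"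
    by (simp add: lookup_add power_add prod.distrib)
  also have "\<dots> = mon w e * mon w e'"
    by (simp add: mon_eq_prod[of ?F])
  finally show ?thesis .
qed

lemma subst_eq_sum:
  assumes "finite F" "Poly_Mapping.keys f \<subseteq> F"
  shows "subst w f = (\<Sum>e\<in>F. Const (Poly_Mapping.lookup f e) * mon w e)"
  unfolding subst_def mon_def[symmetric]
  by (rule sum.mono_neutral_left) (use assms in \<open>auto simp: in_keys_iff\<close>)

lemma subst_add: "subst w (f + g) = subst w f + subst w g"
proof -
  let ?F = "Poly_Mapping.keys f \<union> Poly_Mapping.keys g"
  have "subst w (f + g) = (\<Sum>e\<in>?F. Const (Poly_Mapping.lookup (f + g) e) * mon w e)"
    by (rule subst_eq_sum) (use Poly_Mapping.keys_add[of f g] in auto)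
  also have "\<dots> = subst w f + subst w g"
    by (simp add: lookup_add Const_add distrib_right sum.distrib subst_eq_sum[of ?F])
  finally show ?thesis .
qed

lemma subst_single: "subst w (Poly_Mapping.single e c) = Const c * mon w e"
  by (subst subst_eq_sum[of "{e}"]) auto

lemma subst_0 [simp]: "subst w 0 = 0"
  by (simp add: subst_def)

text \<open>Stated for values in any monoid because it serves twice: for polynomials as sums of
  terms and for exponent vectors as sums of single exponents.\<close>

lemma mpoly_induct [case_names zero single_add]:
  fixes f :: "'a \<Rightarrow>\<^sub>0 'b::monoid_add"
  assumes zero: "Q 0"
    and single_add: "\<And>e c f. Q f \<Longrightarrow> Q (Poly_Mapping.single e c + f)"
  shows "Q f"
proof (induction f rule: update_induct)
  case const
  show ?case by (rule zero)
next
  case (update f a b)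
  have "Poly_Mapping.update a b f = Poly_Mapping.single a b + f"
    using update(1)
    by (intro poly_mapping_eqI)
      (auto simp: lookup_update lookup_add lookup_single in_keys_iff when_def)
  then show ?case using single_add update by simp
qed

text \<open>Both sides are additive in each factor, so only a product of two terms has to be
  checked; there \<open>mon_add\<close> does it.\<close>

lemma subst_mult: "subst w (f * g) = subst w f * subst w g"
proof (induction f rule: mpoly_induct)
  case (single_add e c f)
  have "subst w (Poly_Mapping.single e c * g) = subst w (Poly_Mapping.single e c) * subst w g"
  proof (induction g rule: mpoly_induct)
    case (single_add e' c' g)
    then show ?case
      by (simp add: distrib_left subst_add mult_single subst_single mon_add Const_mult ac_simps)
  qed simp
  with single_add show ?case by (simp add: distrib_right subst_add)
qed simp

lemma subst_Const [simp]: "subst w (Const c) = Const c"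
  unfolding Const_def by (simp add: subst_single mon_def Const_def)

lemma subst_X [simp]: "subst w (X i) = w i"
  unfolding X_def by (simp add: subst_single mon_def)

lemma subst_1 [simp]: "subst w 1 = 1"
  using subst_Const[of w 1] by simp

lemma subst_of_int [simp]: "subst w (of_int k) = of_int k"
  using subst_Const[of w "of_int k"] by (simp add: Const_of_int)

lemma subst_of_nat [simp]: "subst w (of_nat k) = of_nat k"
  using subst_of_int[of w "int k"] by simp

lemma subst_uminus: "subst w (- f) = - subst w f"
  using subst_add[of w f "- f"] by (simp add: eq_neg_iff_add_eq_0 add.commute)

lemma subst_diff: "subst w (f - g) = subst w f - subst w g"
  using subst_add[of w f "- g"] by (simp add: subst_uminus)

lemma subst_power: "subst w (f ^ k) = subst w f ^ k"
  by (induction k) (simp_all add: subst_mult)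

lemma subst_sum: "subst w (sum f S) = (\<Sum>i\<in>S. subst w (f i))"
  by (induction S rule: infinite_finite_induct) (simp_all add: subst_add)

lemmas subst_simps = subst_add subst_mult subst_uminus subst_diff subst_power subst_sum

lemma subst_poly: "subst w (poly p z) = poly (map_poly (subst w) p) (subst w z)"
  by (induction p) (simp_all add: subst_add subst_mult map_poly_pCons)


section \<open>Generated subalgebras\<close>

lemma of_int_in_generated [intro]: "of_int k \<in> generated_subalgebra S"
  using generated_subalgebra.const[of "of_int k" S] by (simp add: Const_of_int)

lemma zero_in_generated [intro]: "0 \<in> generated_subalgebra S"
  using of_int_in_generated[of 0] by simp

lemma one_in_generated [intro]: "1 \<in> generated_subalgebra S"
  using of_int_in_generated[of 1] by simp

lemma uminus_in_generated: "f \<in> generated_subalgebra S \<Longrightarrow> - f \<in> generated_subalgebra S"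
  using generated_subalgebra.mult[OF of_int_in_generated[of "-1"]] by fastforce

lemma diff_in_generated:
  "f \<in> generated_subalgebra S \<Longrightarrow> g \<in> generated_subalgebra S \<Longrightarrow> f - g \<in> generated_subalgebra S"
  using generated_subalgebra.add[OF _ uminus_in_generated] by fastforce

lemma power_in_generated: "f \<in> generated_subalgebra S \<Longrightarrow> f ^ k \<in> generated_subalgebra S"
  by (induction k) (auto intro: generated_subalgebra.mult)

lemma sum_in_generated:
  "(\<And>i. i \<in> I \<Longrightarrow> f i \<in> generated_subalgebra S) \<Longrightarrow> sum f I \<in> generated_subalgebra S"
  by (induction I rule: infinite_finite_induct) (auto intro: generated_subalgebra.add)

lemma prod_in_generated:
  "(\<And>i. i \<in> I \<Longrightarrow> f i \<in> generated_subalgebra S) \<Longrightarrow> prod f I \<in> generated_subalgebra S"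
  by (induction I rule: infinite_finite_induct) (auto intro: generated_subalgebra.mult)

lemmas generated_intros =
  generated_subalgebra.add generated_subalgebra.mult diff_in_generated uminus_in_generated
  power_in_generated sum_in_generated prod_in_generated of_int_in_generated
  zero_in_generated one_in_generated

lemma generated_subset:
  assumes "S \<subseteq> generated_subalgebra T"
  shows "generated_subalgebra S \<subseteq> generated_subalgebra T"
proof
  fix f assume "f \<in> generated_subalgebra S"
  then show "f \<in> generated_subalgebra T"
    by induction (use assms in \<open>auto intro: generated_subalgebra.intros\<close>)
qed

section \<open>The polynomial ring as the subalgebra generated by its variables\<close>

lemma subst_X_self: "subst X f = f"
proof (induction f rule: mpoly_induct)
  case (single_add e c f)
  have "mon X e = Poly_Mapping.single e (1::'a)"
  proof (induction e rule: mpoly_induct)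
    case (single_add i k e)
    have "X i ^ k = Poly_Mapping.single (Poly_Mapping.single i k) (1::'a)"
      by (induction k) (simp_all add: X_def mult_single flip: Poly_Mapping.single_add)
    then have "mon X (Poly_Mapping.single i k) = Poly_Mapping.single (Poly_Mapping.single i k) (1::'a)"
      by (cases "k = 0") (simp_all add: mon_def)
    then show ?case
      using single_add by (simp add: mon_add mult_single)
  qed (simp add: mon_def)
  with single_add show ?case
    by (simp add: subst_add subst_single Const_def mult_single)
qed simp

text \<open>Replaces reasoning about supports by induction over generators: algebra maps that agree
  on the variables agree on \<open>P n\<close>. One inclusion reads \<open>subst X f = f\<close> as
  an expression of \<open>f\<close> in the variables.\<close>

lemma P_eq_generated: "P n = generated_subalgebra (X ` {1..n})"
proof (intro equalityI subsetI)
  fix f :: "'a mpoly" assume "f \<in> P n"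
  then have "subst X f \<in> generated_subalgebra (X ` {1..n})"
    unfolding subst_def P_def
    by (intro generated_intros generated_subalgebra.const generated_subalgebra.gen) auto
  then show "f \<in> generated_subalgebra (X ` {1..n})" by (simp add: subst_X_self)
next
  fix f :: "'a mpoly" assume "f \<in> generated_subalgebra (X ` {1..n})"
  then show "f \<in> P n"
  proof induction
    case (add f g)
    then show ?case using Poly_Mapping.keys_add[of f g] by (auto simp: P_def)
  next
    case (mult f g)
    show ?case unfolding P_def
    proof (intro CollectI ballI)
      fix e assume "e \<in> Poly_Mapping.keys (f * g)"
      then obtain a b where "e = a + b" "a \<in> Poly_Mapping.keys f" "b \<in> Poly_Mapping.keys g"
        using keys_mult[of f g] by blast
      moreover from this have "Poly_Mapping.keys a \<subseteq> {1..n}" "Poly_Mapping.keys b \<subseteq> {1..n}"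
        using mult.IH unfolding P_def by blast+
      ultimately show "Poly_Mapping.keys e \<subseteq> {1..n}"
        using Poly_Mapping.keys_add[of a b] by blast
    qed
  qed (auto simp: P_def Const_def X_def split: if_splits)
qed

lemma X_in_P: "1 \<le> i \<Longrightarrow> i \<le> n \<Longrightarrow> X i \<in> P n"
  by (auto simp: P_eq_generated intro: generated_subalgebra.gen)

lemma Const_in_P: "Const c \<in> P n"
  by (simp add: P_eq_generated generated_subalgebra.const)

lemma P_mono: "i \<le> n \<Longrightarrow> P i \<subseteq> P n"
  unfolding P_def by fastforce

lemmas P_intros = generated_intros[where S = "X ` {1..n}" for n, folded P_eq_generated]

lemma subst_subst_eq:
  assumes "f \<in> P n" "\<And>i. 1 \<le> i \<Longrightarrow> i \<le> n \<Longrightarrow> subst g (w i) = subst h (w' i)"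
  shows "subst g (subst w f) = subst h (subst w' f)"
  using assms(1) unfolding P_eq_generated
  by induction (use assms(2) in \<open>auto simp: subst_simps\<close>)

lemma subst_cong_P:
  assumes "f \<in> P n" "\<And>i. 1 \<le> i \<Longrightarrow> i \<le> n \<Longrightarrow> w i = w' i"
  shows "subst w f = subst w' f"
  using assms(1) unfolding P_eq_generated
  by induction (use assms(2) in \<open>auto simp: subst_simps\<close>)


section \<open>Triangular families\<close>

text \<open>For \<open>i = 1\<close> the remainder \<open>q\<close> lies in \<open>P 0\<close>, so
  it is a constant.\<close>

definition triangular :: "nat \<Rightarrow> (nat \<Rightarrow> 'k::field mpoly) \<Rightarrow> bool" where
  "triangular n y \<longleftrightarrow>
     (\<forall>i \<in> {1..n}. \<exists>c q. c \<noteq> 0 \<and> q \<in> P (i - 1) \<and> y i = Const c * X i + q)"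

text \<open>Since \<open>c\<close> is invertible, \<open>y i = Const c * X i + q\<close> can be
  solved for \<open>X i\<close>, and \<open>q\<close> involves only variables already expressed
  through the family.\<close>

lemma triangular_generates:
  assumes "triangular n y"
  shows "P n \<subseteq> generated_subalgebra (y ` {1..n})"
proof -
  have "X i \<in> generated_subalgebra (y ` {1..n})" if "i \<in> {1..n}" for i
    using that
  proof (induction i rule: less_induct)
    case (less i)
    obtain c q where c: "c \<noteq> 0" "q \<in> P (i - 1)" "y i = Const c * X i + q"
      using assms less.prems unfolding triangular_def by blast
    have "q \<in> generated_subalgebra (X ` {1..i - 1})"
      using c(2) by (simp add: P_eq_generated)
    moreover have "X ` {1..i - 1} \<subseteq> generated_subalgebra (y ` {1..n})"
      using less by auto
    ultimately have q: "q \<in> generated_subalgebra (y ` {1..n})"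
      using generated_subset by blast
    have "X i = Const (inverse c) * (y i - q)"
      using c(1) by (simp add: c(3) Const_mult[symmetric] mult.assoc[symmetric])
    moreover have "y i \<in> generated_subalgebra (y ` {1..n})"
      using less.prems by (auto intro: generated_subalgebra.gen)
    ultimately show ?case
      using q by (auto intro: generated_intros generated_subalgebra.const)
  qed
  then show ?thesis
    unfolding P_eq_generated by (intro generated_subset) auto
qed

text \<open>This is the universal property of free generators, and algebraic independence will come
  from it. The images of the variables are chosen one after another, since \<open>X i\<close> enters
  the family only from \<open>y i\<close> on.\<close>

lemma triangular_free:
  assumes "triangular n y"
  shows "\<exists>g. \<forall>i \<in> {1..n}. subst g (y i) = t i"
  using assms
proof (induction n)
  case (Suc n)
  then have "triangular n y" by (auto simp: triangular_def)
  with Suc.IH obtain g where g: "\<And>i. i \<in> {1..n} \<Longrightarrow> subst g (y i) = t i" by blast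
  obtain c q where c: "c \<noteq> 0" "q \<in> P n" "y (Suc n) = Const c * X (Suc n) + q"
    using bspec[OF Suc.prems[unfolded triangular_def], of "Suc n"] by auto
  \<comment> \<open>The new value is the solution \<open>z\<close> of
    \<open>Const c * z + subst g q = t (Suc n)\<close>; changing \<open>g\<close> at
    \<open>Suc n\<close> leaves \<open>P n\<close> unaffected.\<close>
  define g' where "g' = g(Suc n := Const (inverse c) * (t (Suc n) - subst g q))"
  have g': "subst g' f = subst g f" if "f \<in> P n" for f
    using that by (rule subst_cong_P) (auto simp: g'_def)
  have "y i \<in> P n" if i: "i \<in> {1..n}" for i
  proof -
    obtain c q where "q \<in> P (i - 1)" and y: "y i = Const c * X i + q"
      using \<open>triangular n y\<close> i unfolding triangular_def by blast
    moreover have "P (i - 1) \<subseteq> P n"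
      using i by (intro P_mono) auto
    moreover have "X i \<in> P n"
      using i by (intro X_in_P) auto
    ultimately show ?thesis
      unfolding y by (intro P_intros Const_in_P) auto
  qed
  then have "subst g' (y i) = t i" if "i \<in> {1..n}" for i
    using g g' that by simp
  moreover have "subst g' (y (Suc n)) = t (Suc n)"
    using c(1) by (simp add: c(3) subst_simps g'[OF c(2)])
      (simp add: g'_def Const_mult[symmetric] mult.assoc[symmetric])
  ultimately have "\<forall>i \<in> {1..Suc n}. subst g' (y i) = t i"
    by (auto simp: le_Suc_eq)
  then show ?case by blast
qed simp


section \<open>Invariance of the quadratic forms\<close>

text \<open>Indices and coefficient arguments are integers, so that \<open>m - 1\<close> and
  \<open>c (- 1)\<close> make sense in the shift and Pascal rules.\<close>

definition lincomb :: "(int \<Rightarrow> int) \<Rightarrow> (int \<Rightarrow> 'a::comm_ring_1) \<Rightarrow> nat \<Rightarrow> int \<Rightarrow> 'a" where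
  "lincomb c x d m = (\<Sum>s = 0..d. of_int (c (int s)) * x (m + int s))"

lemma lincomb_shift:
  assumes "\<And>i. x' i = x i + x (i - 1)"
  shows "lincomb c x' d m = lincomb c x d m + lincomb c x d (m - 1)"
  by (simp add: lincomb_def assms distrib_left sum.distrib algebra_simps)

text \<open>Passing to \<open>c s + c (s - 1)\<close> multiplies the generating polynomial of
  \<open>c\<close> by \<open>1 + T\<close>, with \<open>T\<close> the index shift; the two vanishing
  conditions say that no term is lost at the ends.\<close>

lemma lincomb_pascal:
  assumes "c (- 1) = 0" "c (int d + 1) = 0"
  shows "lincomb (\<lambda>s. c s + c (s - 1)) x (Suc d) m = lincomb c x d m + lincomb c x d (m + 1)"
proof -
  have "(\<Sum>s = 0..Suc d. of_int (c (int s)) * x (m + int s)) = lincomb c x d m"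
    using assms(2) by (simp add: lincomb_def add.commute)
  moreover have "(\<Sum>s = 0..Suc d. of_int (c (int s - 1)) * x (m + int s)) = lincomb c x d (m + 1)"
    using assms(1)
    by (simp only: sum.atLeast0_atMost_Suc_shift) (simp add: lincomb_def algebra_simps)
  ultimately show ?thesis
    by (simp add: lincomb_def distrib_right sum.distrib del: sum.atLeast0_atMost_Suc)
qed

lemma lincomb_add: "lincomb (\<lambda>s. c s + c' s) x d m = lincomb c x d m + lincomb c' x d m"
  by (simp add: lincomb_def distrib_right sum.distrib)

section \<open>Pascal recursions for the coefficients\<close>

lemma binom_pascal: "0 \<le> a \<Longrightarrow> binom (a + 1) b = binom a b + binom a (b - 1)"
proof -
  assume a: "0 \<le> a"
  then obtain n where n: "a = int n" using nonneg_int_cases by blast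
  show ?thesis
  proof (cases "b \<le> 0")
    case True
    then show ?thesis using a by (auto simp: binom_def)
  next
    case False
    then obtain j where j: "b = int (Suc j)"
      by (metis linorder_not_le pos_int_cases Suc_pred)
    show ?thesis
      by (auto simp: n j binom_def nat_add_distrib not_le binomial_eq_0)
  qed
qed

text \<open>Up to sign, \<open>lambda_coeff k i j\<close> with \<open>d = k - i\<close> and
  \<open>s = j - k\<close>; the value \<open>d = k\<close> gives \<open>mu_coeff\<close>.\<close>

definition tcoeff :: "nat \<Rightarrow> int \<Rightarrow> int" where
  "tcoeff d s = binom (int d) s + binom (int d - 1) (s - 1)"

text \<open>Up to sign, \<open>alpha_coeff k i j\<close> with \<open>d = k - i\<close> and
  \<open>s = j - k - 1\<close>; for \<open>k \<ge> 2\<close> the value \<open>d = k\<close> gives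
  \<open>beta_coeff\<close>.\<close>

definition acoeff :: "nat \<Rightarrow> int \<Rightarrow> int" where
  "acoeff d s = 2 * binom (int d - 1) s + 3 * binom (int d - 1) (s - 1)
     + (int d - 1) * (binom (int d) s + binom (int d - 1) (s - 1))"

text \<open>The bound on \<open>d\<close> keeps the upper arguments nonnegative: Pascal's rule for
  \<open>binom\<close> fails at \<open>a = -1\<close>, \<open>b = 0\<close>.\<close>

lemma tcoeff_Suc: "1 \<le> d \<Longrightarrow> tcoeff (Suc d) s = tcoeff d s + tcoeff d (s - 1)"
  using binom_pascal[of "int d" s] binom_pascal[of "int d - 1" "s - 1"]
  by (simp add: tcoeff_def add.commute)

text \<open>The last part of \<open>acoeff d s\<close> is \<open>(int d - 1) * tcoeff d s\<close>.
  Everything obeys Pascal's rule except that the factor grows by one, which leaves one extra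
  \<open>tcoeff (Suc d) s\<close>.\<close>

lemma acoeff_Suc:
  assumes "1 \<le> d"
  shows "acoeff (Suc d) s = acoeff d s + acoeff d (s - 1) + tcoeff (Suc d) s"
  using binom_pascal[of "int d" s] binom_pascal[of "int d - 1" "s - 1"]
    binom_pascal[of "int d - 1" s] assms
  by (simp add: tcoeff_def acoeff_def algebra_simps)

lemma lincomb_tcoeff_Suc:
  assumes "1 \<le> d"
  shows "lincomb (tcoeff (Suc d)) x (Suc d) m
     = lincomb (tcoeff d) x d m + lincomb (tcoeff d) x d (m + 1)"
proof -
  have "tcoeff (Suc d) = (\<lambda>s. tcoeff d s + tcoeff d (s - 1))"
    using assms by (simp add: fun_eq_iff tcoeff_Suc)
  then show ?thesis
    using lincomb_pascal[of "tcoeff d" d x m] by (simp add: tcoeff_def binom_def)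
qed

lemma lincomb_acoeff_Suc:
  assumes "1 \<le> d"
  shows "lincomb (acoeff (Suc d)) x (Suc d) m
     = lincomb (acoeff d) x d m + lincomb (acoeff d) x d (m + 1)
       + lincomb (tcoeff (Suc d)) x (Suc d) m"
proof -
  have "acoeff (Suc d) = (\<lambda>s. (acoeff d s + acoeff d (s - 1)) + tcoeff (Suc d) s)"
    using assms by (simp add: fun_eq_iff acoeff_Suc)
  then show ?thesis
    using lincomb_pascal[of "acoeff d" d x m]
      lincomb_add[of "\<lambda>s. acoeff d s + acoeff d (s - 1)" "tcoeff (Suc d)" x "Suc d" m]
    by (simp add: acoeff_def binom_def)
qed

section \<open>The quadratic forms and their behaviour under the shift\<close>

definition qu :: "(int \<Rightarrow> 'a::comm_ring_1) \<Rightarrow> nat \<Rightarrow> 'a" where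
  "qu x k = x (int k) ^ 2
     + (\<Sum>d = 1..k. (-1) ^ d * x (int k - int d) * lincomb (tcoeff d) x d (int k))"

definition qv :: "(int \<Rightarrow> 'a::comm_ring_1) \<Rightarrow> nat \<Rightarrow> 'a" where
  "qv x k = x (int k) * x (int k + 1)
     + (\<Sum>d = 1..k. (-1) ^ d * x (int k - int d) * lincomb (acoeff d) x d (int k + 1))"

lemma sum_telescope_nat:
  fixes g :: "nat \<Rightarrow> 'a::ab_group_add"
  shows "(\<Sum>d = 1..k. g d - g (Suc d)) = g 1 - g (Suc k)"
  by (induction k) auto

lemma tcoeff_1: "tcoeff 1 0 = 1" "tcoeff 1 1 = 2"
  by (simp_all add: tcoeff_def binom_def)

lemma acoeff_1: "acoeff 1 0 = 2" "acoeff 1 1 = 3"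
  by (simp_all add: acoeff_def binom_def)

text \<open>In each shifted product the part with \<open>x (k - d - 1)\<close> carries the sum of
  two windows, which the Pascal rule merges into the window for \<open>d + 1\<close>. Hence the
  changes telescope.\<close>

lemma qu_shift:
  fixes x x' :: "int \<Rightarrow> 'a::comm_ring_1"
  assumes x': "\<And>i. x' i = x i + x (i - 1)" and "x (-1) = 0" and "1 \<le> k"
  shows "qu x' k = qu x k"
proof -
  let ?T = "\<lambda>d m. lincomb (tcoeff d) x d m"
  define g where "g d = (-1) ^ d * x (int k - int d) * ?T d (int k - 1)" for d
  have "(-1) ^ d * x' (int k - int d) * lincomb (tcoeff d) x' d (int k)
      = (-1) ^ d * x (int k - int d) * ?T d (int k) + (g d - g (Suc d))" if "d \<in> {1..k}" for d
  proof -
    have T: "?T (Suc d) (int k - 1) = ?T d (int k - 1) + ?T d (int k)"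
      using lincomb_tcoeff_Suc[of d x "int k - 1"] that by simp
    have i: "int k - int (Suc d) = int k - int d - 1" by simp
    show ?thesis
      unfolding g_def T i x' lincomb_shift[of x' x, OF x'] by (simp add: algebra_simps)
  qed
  then have S: "(\<Sum>d = 1..k. (-1) ^ d * x' (int k - int d) * lincomb (tcoeff d) x' d (int k))
      = (\<Sum>d = 1..k. (-1) ^ d * x (int k - int d) * ?T d (int k)) + (g 1 - g (Suc k))"
    unfolding sum_telescope_nat[symmetric] sum.distrib[symmetric] by (intro sum.cong) auto
  \<comment> \<open>The upper end contains the factor \<open>x (-1)\<close>; the lower end
    \<open>g 1\<close> cancels the change in \<open>x (int k) ^ 2\<close>.\<close>
  have gk: "g (Suc k) = 0" using assms(2) by (simp add: g_def)
  have g1: "g 1 = - x (int k - 1) * (x (int k - 1) + 2 * x (int k))"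
    using tcoeff_1 by (simp add: g_def lincomb_def)
  show ?thesis
    unfolding qu_def x'[of "int k"] S gk g1 by (simp add: power2_eq_square algebra_simps)
qed

text \<open>The telescoping is that of \<open>qu_shift\<close>, but the extra \<open>tcoeff\<close>
  term in the recursion for \<open>acoeff\<close> survives and accumulates to
  \<open>qu x k\<close>.\<close>

lemma qv_shift:
  fixes x x' :: "int \<Rightarrow> 'a::comm_ring_1"
  assumes x': "\<And>i. x' i = x i + x (i - 1)" and "x (-1) = 0" and "1 \<le> k"
  shows "qv x' k = qv x k + qu x k"
proof -
  let ?T = "\<lambda>d m. lincomb (tcoeff d) x d m" and ?A = "\<lambda>d m. lincomb (acoeff d) x d m"
  define g where "g d = (-1) ^ d * x (int k - int d) * ?A d (int k)" for d
  define h where "h d = (-1) ^ d * x (int k - int d) * ?T d (int k)" for d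
  have "(-1) ^ d * x' (int k - int d) * lincomb (acoeff d) x' d (int k + 1)
      = (-1) ^ d * x (int k - int d) * ?A d (int k + 1) + (g d - g (Suc d)) + h (Suc d)"
    if "d \<in> {1..k}" for d
  proof -
    have A: "?A (Suc d) (int k) = ?A d (int k) + ?A d (int k + 1) + ?T (Suc d) (int k)"
      using lincomb_acoeff_Suc[of d x "int k"] that by simp
    have i: "int k - int (Suc d) = int k - int d - 1" by simp
    show ?thesis
      unfolding g_def h_def A i x' lincomb_shift[of x' x, OF x'] by (simp add: algebra_simps)
  qed
  then have S: "(\<Sum>d = 1..k. (-1) ^ d * x' (int k - int d) * lincomb (acoeff d) x' d (int k + 1))
      = (\<Sum>d = 1..k. (-1) ^ d * x (int k - int d) * ?A d (int k + 1)) + (g 1 - g (Suc k))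
        + (\<Sum>d = 1..k. h (Suc d))"
    unfolding sum_telescope_nat[symmetric] sum.distrib[symmetric] by (intro sum.cong) auto
  \<comment> \<open>The sum of all \<open>h d\<close> is the sum inside \<open>qu\<close>. The
    missing square \<open>x (int k) ^ 2\<close> comes from the shifted product
    \<open>x' (int k) * x' (int k + 1)\<close>, whose other new terms cancel against
    \<open>g 1 - h 1\<close>.\<close>
  have H: "(\<Sum>d = 1..k. h (Suc d)) = (\<Sum>d = 1..k. h d) - h 1 + h (Suc k)"
    by (induction k) auto
  have gk: "g (Suc k) = 0" "h (Suc k) = 0" using assms(2) by (simp_all add: g_def h_def)
  have g1: "g 1 = - x (int k - 1) * (2 * x (int k) + 3 * x (int k + 1))"
    "h 1 = - x (int k - 1) * (x (int k) + 2 * x (int k + 1))"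
    using tcoeff_1 acoeff_1 by (simp_all add: g_def h_def lincomb_def)
  show ?thesis
    unfolding qv_def qu_def x'[of "int k"] x'[of "int k + 1"] S H gk g1 h_def[symmetric]
    by (simp add: power2_eq_square algebra_simps)
qed


section \<open>Invariance and leading terms of the generators\<close>

definition Xint :: "int \<Rightarrow> 'k::comm_ring_1 mpoly" where
  "Xint i = (if i < 0 then 0 else if i = 0 then -1 else X (nat i))"

lemma Xint_of_nat [simp]: "1 \<le> i \<Longrightarrow> Xint (int i) = X i"
  by (simp add: Xint_def)

lemma sum_atLeastAtMost_eq_lincomb:
  assumes "a \<le> b" "1 \<le> a"
  shows "(\<Sum>j = a..b. of_int (f (int j - int a)) * X j) = lincomb f Xint (b - a) (int a)"
proof -
  have "(\<Sum>j = a..b. of_int (f (int j - int a)) * X j)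
      = (\<Sum>j = 0 + a..(b - a) + a. of_int (f (int j - int a)) * Xint (int j))"
    using assms by (intro sum.cong) auto
  also have "\<dots> = lincomb f Xint (b - a) (int a)"
    unfolding sum.shift_bounds_cl_nat_ivl by (simp add: lincomb_def add.commute)
  finally show ?thesis .
qed

lemma lambda_coeff_eq:
  "1 \<le> i \<Longrightarrow> i < k \<Longrightarrow> lambda_coeff k i j = (-1) ^ (k - i) * tcoeff (k - i) (int j - int k)"
  by (simp add: lambda_coeff_def tcoeff_def of_nat_diff)

lemma mu_coeff_eq: "mu_coeff k j = (-1) ^ (k - 1) * tcoeff k (int j - int k)"
  by (simp add: mu_coeff_def tcoeff_def)

lemma alpha_coeff_eq:
  "i < k \<Longrightarrow> alpha_coeff k i j = (-1) ^ (k - i) * acoeff (k - i) (int j - int (k + 1))"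
  by (simp add: alpha_coeff_def acoeff_def of_nat_diff algebra_simps)

text \<open>The definition of \<open>beta_coeff\<close> is the recursion \<open>acoeff_Suc\<close>
  from \<open>k - 1\<close> to \<open>k\<close>, which needs \<open>k - 1 \<ge> 1\<close>.\<close>

lemma beta_coeff_eq:
  assumes "2 \<le> k" "k + 1 \<le> j"
  shows "beta_coeff k j = (-1) ^ (k - 1) * acoeff k (int j - int (k + 1))"
proof -
  have "acoeff k (int j - int (k + 1)) = acoeff (k - 1) (int j - int (k + 1))
     + acoeff (k - 1) (int j - int (k + 1) - 1) + tcoeff k (int j - int (k + 1))"
    using acoeff_Suc[of "k - 1" "int j - int (k + 1)"] assms(1) by simp
  then show ?thesis
    using assms unfolding beta_coeff_def
    by (simp add: alpha_coeff_eq mu_coeff_eq of_nat_diff algebra_simps)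
qed

lemma sum_reverse_minus:
  fixes f :: "nat \<Rightarrow> 'a::comm_monoid_add"
  shows "(\<Sum>i = 1..k - 1. f i) = (\<Sum>d = 1..k - 1. f (k - d))"
  by (rule sum.reindex_bij_witness[of _ "\<lambda>i. k - i" "\<lambda>i. k - i"]) auto

text \<open>Reindexing by \<open>d = k - i\<close> turns both double sums into the shape of the
  forms: \<open>a = k\<close> with \<open>tcoeff\<close> for \<open>u\<close>, and
  \<open>a = k + 1\<close> with \<open>acoeff\<close> for \<open>v\<close>.\<close>

lemma bilinear_sum_eq_lincomb:
  assumes "1 \<le> a" "\<And>i. i \<in> {1..k - 1} \<Longrightarrow> b i = a + (k - i)"
    and "\<And>i j. i \<in> {1..k - 1} \<Longrightarrow> f i j = (-1) ^ (k - i) * c (k - i) (int j - int a)"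
  shows "(\<Sum>i = 1..k - 1. \<Sum>j = a..b i. of_int (f i j) * X i * (X j :: 'k::comm_ring_1 mpoly))
    = (\<Sum>d = 1..k - 1. (-1) ^ d * Xint (int k - int d) * lincomb (c d) Xint d (int a))"
proof (subst sum_reverse_minus, intro sum.cong refl)
  fix d assume d: "d \<in> {1..k - 1}"
  then have i: "k - d \<in> {1..k - 1}" "k - (k - d) = d" by auto
  have X: "Xint (int k - int d) = (X (k - d) :: 'k mpoly)"
    using d Xint_of_nat[of "k - d", where 'a = 'k] i(1) by (auto simp: of_nat_diff)
  have "lincomb (c d) Xint d (int a)
      = (\<Sum>j = a..a + d. of_int (c d (int j - int a)) * (X j :: 'k mpoly))"
    using sum_atLeastAtMost_eq_lincomb[of a "a + d" "c d", where 'a = 'k] assms(1) by simp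
  then show "(\<Sum>j = a..b (k - d). of_int (f (k - d) j) * X (k - d) * (X j :: 'k mpoly))
      = (-1) ^ d * Xint (int k - int d) * lincomb (c d) Xint d (int a)"
    unfolding X assms(2)[OF i(1)] assms(3)[OF i(1)] i(2)
    by (simp add: sum_distrib_left ac_simps)
qed

lemma u_eq_qu:
  assumes "1 \<le> k"
  shows "u k = (qu Xint k :: 'k::comm_ring_1 mpoly)"
proof -
  have quad: "(\<Sum>i = 1..k - 1. \<Sum>j = k..2 * k - i.
        of_int (lambda_coeff k i j) * X i * (X j :: 'k mpoly))
    = (\<Sum>d = 1..k - 1. (-1) ^ d * Xint (int k - int d) * lincomb (tcoeff d) Xint d (int k))"
    by (rule bilinear_sum_eq_lincomb) (use assms in \<open>auto simp: lambda_coeff_eq\<close>)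
  have "(\<Sum>i = k..2 * k. of_int (tcoeff k (int i - int k)) * (X i :: 'k mpoly))
      = lincomb (tcoeff k) Xint k (int k)"
    using sum_atLeastAtMost_eq_lincomb[of k "2 * k" "tcoeff k"] assms by simp
  moreover have "(\<Sum>i = k..2 * k. of_int (mu_coeff k i) * (X i :: 'k mpoly))
      = (-1) ^ (k - 1) * (\<Sum>i = k..2 * k. of_int (tcoeff k (int i - int k)) * X i)"
    unfolding sum_distrib_left by (intro sum.cong) (auto simp: mu_coeff_eq)
  \<comment> \<open>The linear part is the summand \<open>d = k\<close> of \<open>qu\<close>: the
    factor \<open>Xint 0 = -1\<close> accounts for the sign \<open>(-1) ^ (k - 1)\<close>.\<close>
  ultimately have lin: "(\<Sum>i = k..2 * k. of_int (mu_coeff k i) * (X i :: 'k mpoly))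
      = (-1) ^ k * Xint (int k - int k) * lincomb (tcoeff k) Xint k (int k)"
    using assms by (cases k) (simp_all add: Xint_def)
  show ?thesis
    unfolding u_def qu_def quad lin using assms by (cases k) (simp_all del: of_nat_Suc)
qed

lemma v_eq_qv:
  assumes "2 \<le> k"
  shows "v k = X 1 * u k + (qv Xint k :: 'k::comm_ring_1 mpoly)"
proof -
  have quad: "(\<Sum>i = 1..k - 1. \<Sum>j = k + 1..2 * k - i + 1.
        of_int (alpha_coeff k i j) * X i * (X j :: 'k mpoly))
    = (\<Sum>d = 1..k - 1. (-1) ^ d * Xint (int k - int d) * lincomb (acoeff d) Xint d (int (k + 1)))"
    by (rule bilinear_sum_eq_lincomb) (use assms in \<open>auto simp: alpha_coeff_eq\<close>)
  have "(\<Sum>i = k + 1..2 * k + 1. of_int (acoeff k (int i - int (k + 1))) * (X i :: 'k mpoly))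
      = lincomb (acoeff k) Xint k (int (k + 1))"
    using sum_atLeastAtMost_eq_lincomb[of "k + 1" "2 * k + 1" "acoeff k"] by simp
  moreover have "(\<Sum>i = k + 1..2 * k + 1. of_int (beta_coeff k i) * (X i :: 'k mpoly))
      = (-1) ^ (k - 1) * (\<Sum>i = k + 1..2 * k + 1. of_int (acoeff k (int i - int (k + 1))) * X i)"
    unfolding sum_distrib_left using assms by (intro sum.cong) (auto simp: beta_coeff_eq)
  ultimately have lin: "(\<Sum>i = k + 1..2 * k + 1. of_int (beta_coeff k i) * (X i :: 'k mpoly))
      = (-1) ^ k * Xint (int k - int k) * lincomb (acoeff k) Xint k (int (k + 1))"
    using assms by (cases k) (simp_all add: Xint_def)
  have 1: "int k + 1 = int (k + 1)" by simp
  show ?thesis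
    unfolding v_def qv_def quad lin 1 using assms Xint_of_nat[of "k + 1", where 'a = 'k]
    by (cases k) (simp_all del: of_nat_Suc of_nat_add)
qed

section \<open>The automorphism as a substitution, and invariance of the generators\<close>

definition shift :: "'k::comm_ring_1 mpoly \<Rightarrow> 'k mpoly" where
  "shift = subst (\<lambda>i. Xint (int i) + Xint (int i - 1))"

text \<open>\<open>shift\<close> does not depend on \<open>n\<close> and will agree with
  \<open>\<sigma>\<close> on \<open>P n\<close>. The values of \<open>Xint\<close> at
  \<open>0\<close> and below make one formula cover every index, including
  \<open>i = 1\<close>.\<close>

lemma shift_Xint: "shift (Xint i) = Xint i + Xint (i - 1)"
  by (auto simp: shift_def Xint_def subst_uminus)

lemma shift_lincomb: "shift (lincomb c x d m) = lincomb c (\<lambda>i. shift (x i)) d m"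
  by (simp add: shift_def lincomb_def subst_simps)

lemma shift_qu: "shift (qu x k) = qu (\<lambda>i. shift (x i)) k"
  unfolding qu_def shift_lincomb[symmetric] by (simp add: shift_def subst_simps)

lemma shift_qv: "shift (qv x k) = qv (\<lambda>i. shift (x i)) k"
  unfolding qv_def shift_lincomb[symmetric] by (simp add: shift_def subst_simps)

lemma shift_u: "1 \<le> k \<Longrightarrow> shift (u k) = u k"
  unfolding u_eq_qu shift_qu by (rule qu_shift) (simp_all add: shift_Xint, simp add: Xint_def)

lemma shift_X1: "shift (X 1) = X 1 - 1"
  using shift_Xint[of 1] by (simp add: Xint_def)

text \<open>For \<open>k \<ge> 2\<close> the loss \<open>- u k\<close> from \<open>X 1 * u k\<close>
  is compensated by the gain \<open>qu Xint k = u k\<close> of \<open>qv\<close>. The polynomial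
  \<open>v 1\<close> is defined separately and is checked by expansion.\<close>

lemma shift_v:
  assumes "1 \<le> k"
  shows "shift (v k) = (v k :: 'k::comm_ring_1 mpoly)"
proof (cases "k = 1")
  case True
  have 2: "shift (X 2) = X 2 + (X 1 :: 'k mpoly)" and 3: "shift (X 3) = X 3 + (X 2 :: 'k mpoly)"
    using shift_Xint[of 2] shift_Xint[of 3] by (simp_all add: Xint_def)
  have 4: "shift 3 = (3 :: 'k mpoly)"
    using subst_of_int[of _ 3] by (simp add: shift_def)
  have "(v 1 :: 'k mpoly) = X 1 ^ 3 + 3 * X 1 * X 2 - X 1 + 3 * X 3" by (simp add: v_def)
  then have "shift (v 1 :: 'k mpoly) = shift (X 1) ^ 3 + shift 3 * shift (X 1) * shift (X 2) - shift (X 1)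
      + shift 3 * shift (X 3)"
    by (simp only: shift_def subst_simps)
  also have "\<dots> = v 1"
    unfolding 2 3 4 shift_X1 by (simp add: v_def power3_eq_cube algebra_simps)
  finally show ?thesis using True by simp
next
  case False
  then have k: "2 \<le> k" using assms by simp
  have "shift (v k :: 'k mpoly) = shift (X 1) * shift (u k) + shift (qv Xint k)"
    by (simp add: v_eq_qv[OF k] shift_def subst_simps)
  also have "shift (qv Xint k :: 'k mpoly) = qv Xint k + qu Xint k"
    unfolding shift_qv by (rule qv_shift) (use k in \<open>simp_all add: shift_Xint, simp add: Xint_def\<close>)
  also have "shift (X 1) * shift (u k) + (qv Xint k + qu Xint k) = (v k :: 'k mpoly)"
    unfolding shift_X1 shift_u[OF assms] v_eq_qv[OF k] u_eq_qu[OF assms, symmetric]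
    by (simp add: algebra_simps)
  finally show ?thesis .
qed

section \<open>Leading variables of the generators\<close>

lemma u_leading:
  assumes "1 \<le> k"
  shows "\<exists>c q. c \<noteq> 0 \<and> q \<in> P (2 * k - 1) \<and> u k = Const (c :: 'k::field_char_0) * X (2 * k) + q"
proof -
  \<comment> \<open>This is \<open>2 * (-1) ^ (k - 1)\<close>, nonzero in characteristic zero. The
    quadratic terms stop at index \<open>2 * k - 1\<close> because \<open>i \<ge> 1\<close>.\<close>
  define c where "c = mu_coeff k (2 * k)"
  define q :: "'k mpoly" where "q = X k ^ 2
     + (\<Sum>i = 1..k - 1. \<Sum>j = k..2 * k - i. of_int (lambda_coeff k i j) * X i * X j)
     + (\<Sum>i = k..2 * k - 1. of_int (mu_coeff k i) * X i)"
  have "{k..2 * k} = insert (2 * k) {k..2 * k - 1}" using assms by auto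
  then have "u k = Const (of_int c) * X (2 * k) + q"
    using assms by (simp add: u_def q_def c_def Const_of_int)
  moreover have "q \<in> P (2 * k - 1)"
    unfolding q_def by (intro P_intros X_in_P) (use assms in auto)
  moreover have "c \<noteq> 0"
    using assms by (simp add: c_def mu_coeff_def binom_def nat_diff_distrib)
  ultimately show ?thesis
    by (intro exI[of _ "of_int c"] exI[of _ q]) simp
qed

lemma u_in_P: "1 \<le> k \<Longrightarrow> 2 * k \<le> n \<Longrightarrow> u k \<in> P n"
  unfolding u_def by (intro P_intros X_in_P) auto

lemma v_leading:
  assumes "1 \<le> k"
  shows "\<exists>c q. c \<noteq> 0 \<and> q \<in> P (2 * k) \<and> v k = Const (c :: 'k::field_char_0) * X (2 * k + 1) + q"
proof (cases "k = 1")
  case True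
  have "X 1 ^ 3 + of_int 3 * X 1 * X 2 - X 1 \<in> (P 2 :: 'k mpoly set)"
    by (intro P_intros X_in_P) auto
  moreover have "v 1 = Const 3 * X 3 + (X 1 ^ 3 + of_int 3 * X 1 * X 2 - (X 1 :: 'k mpoly))"
    using Const_of_int[of 3, where 'a = 'k] by (simp add: v_def)
  ultimately show ?thesis
    using True by (intro exI[of _ 3] exI[of _ "X 1 ^ 3 + of_int 3 * X 1 * X 2 - X 1"]) simp
next
  case False
  then have k: "2 \<le> k" using assms by simp
  \<comment> \<open>This is \<open>(-1) ^ (k - 1) * (2 * k + 1)\<close>; the terms collected in
    \<open>q\<close>, including \<open>X 1 * u k\<close>, reach only
    \<open>X (2 * k)\<close>.\<close>
  define c where "c = beta_coeff k (2 * k + 1)"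
  define q :: "'k mpoly" where "q = X 1 * u k + X k * X (k + 1)
     + (\<Sum>i = 1..k - 1. \<Sum>j = k + 1..2 * k - i + 1. of_int (alpha_coeff k i j) * X i * X j)
     + (\<Sum>i = k + 1..2 * k. of_int (beta_coeff k i) * X i)"
  have "{k + 1..2 * k + 1} = insert (2 * k + 1) {k + 1..2 * k}" using assms by auto
  then have "v k = Const (of_int c) * X (2 * k + 1) + q"
    using k by (simp add: v_def q_def c_def Const_of_int)
  moreover have "q \<in> P (2 * k)"
    unfolding q_def by (intro P_intros X_in_P u_in_P) (use k in auto)
  moreover have "c \<noteq> 0"
    using k by (simp add: c_def beta_coeff_eq acoeff_def binom_def nat_diff_distrib)
  ultimately show ?thesis
    by (intro exI[of _ "of_int c"] exI[of _ q]) simp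
qed

lemma v_in_P:
  assumes "1 \<le> k" "2 * k + 1 \<le> n"
  shows "v k \<in> (P n :: 'k::field_char_0 mpoly set)"
proof -
  obtain c q where "q \<in> P (2 * k)" and v: "v k = Const (c :: 'k) * X (2 * k + 1) + q"
    using v_leading[OF assms(1)] by blast
  moreover have "P (2 * k) \<subseteq> P n"
    using assms by (intro P_mono) simp
  moreover have "X (2 * k + 1) \<in> P n"
    using assms by (intro X_in_P) auto
  ultimately show ?thesis
    unfolding v by (intro P_intros Const_in_P) auto
qed

text \<open>The interleaved order \<open>x1, u1, v1, u2, v2, ...\<close> makes \<open>X j\<close>
  the leading variable of the \<open>j\<close>-th member.\<close>

definition coords :: "nat \<Rightarrow> 'k::field_char_0 mpoly" where
  "coords j = (if j = 1 then X 1 else if even j then u (j div 2) else v (j div 2))"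

lemma triangular_coords: "triangular n coords"
  unfolding triangular_def
proof
  fix j assume j: "j \<in> {1..n}"
  show "\<exists>c q. c \<noteq> 0 \<and> q \<in> P (j - 1) \<and> coords j = Const (c :: 'a) * X j + q"
  proof (cases "j = 1")
    case True
    then show ?thesis
      by (intro exI[of _ 1] exI[of _ 0]) (simp add: coords_def P_def)
  next
    case False
    show ?thesis
    proof (cases "even j")
      case True
      then obtain k where k: "j = 2 * k" by (elim evenE)
      then show ?thesis
        using u_leading[of k, where 'k = 'a] j by (auto simp: coords_def)
    next
      case odd: False
      then obtain k where k: "j = 2 * k + 1" by (elim oddE)
      then show ?thesis
        using v_leading[of k, where 'k = 'a] False by (auto simp: coords_def)
    qed
  qed
qed


section \<open>The invariant ring\<close>

lemma shift_fixes_generated: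
  assumes "\<And>s. s \<in> S \<Longrightarrow> shift s = s" "f \<in> generated_subalgebra S"
  shows "shift f = f"
  using assms(2) by induction (use assms(1) in \<open>auto simp: shift_def subst_simps\<close>)

lemma shift_invariant_poly_const:
  fixes p :: "'k::field_char_0 mpoly poly"
  assumes "\<And>i. shift (coeff p i) = coeff p i" "shift (poly p (X 1)) = poly p (X 1)"
  shows "p = [:poly p (X 1):]"
proof -
  let ?f = "poly p (X 1)"
  have shift_p: "shift (poly p z) = poly p (shift z)" for z
  proof -
    have "map_poly shift p = p"
      using assms(1) by (intro poly_eqI) (simp add: coeff_map_poly shift_def)
    then show ?thesis by (simp add: shift_def subst_poly)
  qed
  have "poly p (X 1 - of_nat j) = ?f" for j
  proof (induction j)
    case (Suc j)
    have "shift (X 1 - of_nat j :: 'k mpoly) = shift (X 1) - of_nat j"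
      by (simp only: shift_def subst_simps subst_of_nat)
    also have "\<dots> = X 1 - of_nat (Suc j)"
      unfolding shift_X1 by simp
    finally show ?case
      using shift_p[of "X 1 - of_nat j"] Suc assms(2) by simp
  qed simp
  then have "range (\<lambda>j. X 1 - of_nat j) \<subseteq> {z. poly (p - [:?f:]) z = 0}"
    by auto
  \<comment> \<open>Characteristic zero makes these points distinct, and over an integral domain a
    nonzero polynomial has only finitely many roots.\<close>
  moreover have "infinite (range (\<lambda>j. X 1 - of_nat j :: 'k mpoly))"
    by (intro range_inj_infinite injI) simp
  ultimately have "p - [:?f:] = 0"
    using poly_roots_finite infinite_super by blast
  then show ?thesis by simp
qed

text \<open>The values at \<open>y\<close> of polynomials with coefficients in the subalgebra
  contain \<open>y\<close>, \<open>S\<close> and the constants, and they are closed under sums and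
  products.\<close>

lemma generated_insert_eq_poly:
  assumes "f \<in> generated_subalgebra (insert y S)"
  shows "\<exists>p. (\<forall>i. coeff p i \<in> generated_subalgebra S) \<and> f = poly p y"
  using assms
proof induction
  case (const c)
  then show ?case
    by (intro exI[of _ "[:Const c:]"])
      (auto simp: coeff_pCons split: nat.split intro: generated_subalgebra.const)
next
  case (gen s)
  show ?case
  proof (cases "s = y")
    case True
    then show ?thesis
      by (intro exI[of _ "[:0, 1:]"]) (auto simp: coeff_pCons split: nat.split)
  next
    case False
    then show ?thesis using gen
      by (intro exI[of _ "[:s:]"])
        (auto simp: coeff_pCons split: nat.split intro: generated_subalgebra.gen)
  qed
next
  case (add f g)
  then obtain p q where "\<forall>i. coeff p i \<in> generated_subalgebra S" "f = poly p y"
    "\<forall>i. coeff q i \<in> generated_subalgebra S" "g = poly q y" by blast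
  then show ?case
    by (intro exI[of _ "p + q"]) (auto intro: generated_subalgebra.add)
next
  case (mult f g)
  then obtain p q where "\<forall>i. coeff p i \<in> generated_subalgebra S" "f = poly p y"
    "\<forall>i. coeff q i \<in> generated_subalgebra S" "g = poly q y" by blast
  then show ?case
    by (intro exI[of _ "p * q"]) (auto simp: coeff_mult intro!: sum_in_generated generated_subalgebra.mult)
qed

theorem theorem1p4:
  fixes n m \<mu> :: nat
    and \<sigma> :: "'k::field_char_0 mpoly \<Rightarrow> 'k mpoly"
  assumes "n \<ge> 2"
    and "algebra_automorphism n \<sigma>"
    and "\<sigma> (X 1) = X 1 - 1"
    and "\<And>i. 2 \<le> i \<Longrightarrow> i \<le> n \<Longrightarrow> \<sigma> (X i) = X i + X (i - 1)"
    and "m = n div 2"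
    and "\<mu> = (n - 1) div 2"
  shows "m + \<mu> = n - 1
    \<and> invariants n \<sigma> = generated_subalgebra (u ` {1..m} \<union> v ` {1..\<mu>})
    \<and> polynomial_ring_in (invariants n \<sigma>) (m + \<mu>) (uv m)
    \<and> polynomial_extension (P n) (invariants n \<sigma>) (X 1)"
proof -
  define S :: "'k mpoly set" where "S = u ` {1..m} \<union> v ` {1..\<mu>}"
  \<comment> \<open>Both maps respect constants, sums and products on \<open>P n\<close>, so
    comparing them on the variables is enough.\<close>
  have \<sigma>: "\<sigma> f = shift f" if "f \<in> P n" for f
    using that unfolding P_eq_generated
  proof induction
    case (gen s)
    then obtain i where i: "s = X i" "1 \<le> i" "i \<le> n" by auto
    then show ?case
      using assms(3) assms(4)[of i] shift_Xint[of "int i", where 'a = 'k] shift_X1[where 'a = 'k]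
        Xint_of_nat[of "i - 1", where 'a = 'k]
      by (cases "i = 1") (auto simp: of_nat_diff)
  qed (use assms(2) in \<open>auto simp: algebra_automorphism_def P_eq_generated shift_def subst_simps\<close>)
  have S_uv: "uv m ` {1..m + \<mu>} = S"
  proof -
    have "{1..m + \<mu>} = {1..m} \<union> (+) m ` {1..\<mu>}"
      by (auto simp: image_iff Bex_def)
    moreover have "uv m ` {1..m} = (u ` {1..m} :: 'k mpoly set)"
      by (intro image_cong) (auto simp: uv_def)
    moreover have "uv m ` (+) m ` {1..\<mu>} = (v ` {1..\<mu>} :: 'k mpoly set)"
      unfolding image_image by (intro image_cong) (auto simp: uv_def)
    ultimately show ?thesis
      unfolding S_def by (simp only: image_Un)
  qed
  have S_P: "S \<subseteq> P n"
    using assms(1,5,6) by (auto simp: S_def intro!: u_in_P v_in_P)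
  then have A_P: "generated_subalgebra S \<subseteq> P n"
    unfolding P_eq_generated by (rule generated_subset)
  have fixed: "shift f = f" if "f \<in> generated_subalgebra S" for f
    using that by (rule shift_fixes_generated[rotated]) (auto simp: S_def shift_u shift_v)
  have poly_rep: "\<exists>p. (\<forall>i. coeff p i \<in> generated_subalgebra S) \<and> f = poly p (X 1)"
    if "f \<in> P n" for f
  proof -
    \<comment> \<open>The bounds match: \<open>2 * k \<le> n\<close> gives \<open>k \<le> m\<close>,
      and \<open>2 * k + 1 \<le> n\<close> gives \<open>k \<le> \<mu>\<close>.\<close>
    have "coords j \<in> insert (X 1) S" if j: "j \<in> {1..n}" for j
    proof -
      consider "j = 1" | k where "j = 2 * k" "1 \<le> k" | k where "j = 2 * k + 1" "1 \<le> k"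
        using j by (cases "even j"; cases "j = 1") (auto elim!: evenE oddE)
      then show ?thesis
        using j assms(5,6) by cases (auto simp: coords_def S_def)
    qed
    then have "coords ` {1..n} \<subseteq> generated_subalgebra (insert (X 1) S)"
      by (intro image_subsetI generated_subalgebra.gen)
    then have "f \<in> generated_subalgebra (insert (X 1) S)"
      using triangular_generates[OF triangular_coords] generated_subset that by blast
    then show ?thesis by (rule generated_insert_eq_poly)
  qed
  have inv: "invariants n \<sigma> = generated_subalgebra S"
  proof (intro equalityI subsetI)
    fix f assume "f \<in> invariants n \<sigma>"
    then have f: "f \<in> P n" "shift f = f" using \<sigma> by (auto simp: invariants_def)
    then obtain p where p: "\<And>i. coeff p i \<in> generated_subalgebra S" "f = poly p (X 1)"
      using poly_rep by blast
    \<comment> \<open>Invariance of the value forces \<open>p\<close> to be constant, so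
      \<open>f\<close> is itself a coefficient of \<open>p\<close>.\<close>
    then have "p = [:f:]"
      using shift_invariant_poly_const[of p] fixed f(2) by simp
    then show "f \<in> generated_subalgebra S"
      using p(1)[of 0] by simp
  next
    fix f assume "f \<in> generated_subalgebra S"
    then show "f \<in> invariants n \<sigma>"
      using A_P \<sigma> fixed by (auto simp: invariants_def)
  qed
  have "algebraically_independent (m + \<mu>) (uv m :: nat \<Rightarrow> 'k mpoly)"
    unfolding algebraically_independent_def
  proof (intro ballI impI)
    fix f :: "'k mpoly" assume f: "f \<in> P (m + \<mu>)" "subst (uv m) f = 0"
    \<comment> \<open>The targets follow the numbering of \<open>uv m\<close>: \<open>u k\<close>
      goes to \<open>X k\<close> and \<open>v k\<close> to \<open>X (m + k)\<close>, so
      \<open>subst g\<close> undoes \<open>subst (uv m)\<close> on \<open>P (m + \<mu>)\<close>. At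
      \<open>j = 1\<close> the formula yields the harmless default \<open>X m\<close>.\<close>
    obtain g where g: "\<And>j. j \<in> {1..n} \<Longrightarrow>
        subst g (coords j) = (X (if even j then j div 2 else m + j div 2) :: 'k mpoly)"
      using triangular_free[OF triangular_coords[of n],
          of "\<lambda>j. X (if even j then j div 2 else m + j div 2)"] by blast
    have "subst g (uv m i) = subst X (X i)" if "1 \<le> i" "i \<le> m + \<mu>" for i
    proof (cases "i \<le> m")
      case True
      then show ?thesis
        using g[of "2 * i"] that assms(5) by (simp add: uv_def coords_def)
    next
      case False
      then show ?thesis
        using g[of "2 * (i - m) + 1"] that assms(1,6) by (simp add: uv_def coords_def)
    qed
    then have "subst g (subst (uv m) f) = subst X (subst X f)"
      by (intro subst_subst_eq[OF f(1)])
    then show "f = 0" using f(2) by (simp add: subst_X_self)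
  qed
  moreover have "polynomial_extension (P n) (generated_subalgebra S) (X 1)"
    unfolding polynomial_extension_def
  proof (intro conjI allI impI equalityI subsetI)
    fix f assume "f \<in> {poly p (X 1) | p. \<forall>i. coeff p i \<in> generated_subalgebra S}"
    then obtain p where "\<And>i. coeff p i \<in> P n" "f = poly p (X 1)"
      using A_P by blast
    then show "f \<in> P n"
      using assms(1) by (auto simp: poly_altdef intro!: P_intros X_in_P)
  next
    fix p assume p: "(\<forall>i. coeff p i \<in> generated_subalgebra S) \<and> poly p (X 1) = 0"
    \<comment> \<open>The value \<open>0\<close> is invariant, so the constancy argument also gives
      transcendence of \<open>X 1\<close>.\<close>
    then have "p = [:poly p (X 1):]"
      by (intro shift_invariant_poly_const) (auto simp: fixed[OF zero_in_generated] intro: fixed)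
    then show "p = 0" using p by simp
  qed (use poly_rep in blast)
  ultimately show ?thesis
    using assms(1,5,6) unfolding inv polynomial_ring_in_def S_uv S_def by auto
qed

end
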